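(* A graph $G$ on $n \geq 5$ vertices is strongly $T_3$-reconstructible if and only if (a) $N(v_1) \setminus \{v_2\} \neq N(v_2) \setminus \{v_1\}$ for all distinct $v_1, v_2 \in V(G)$, and (b) every edge $uv$ of $G$ that is contained in a triangle admits distinct vertices of $G$, one endpoint of the edge playing the role of $u$ and the other the role of $v$, realizing one of the configurations $\mathcal{F}_1, \dots, \mathcal{F}_6$ below (as adjacencies in $G$ among these vertices).
   Context: Graphs are finite, simple, connected and labeled; two labeled graphs are identical iff they have the same vertex set and edge set. $N(v)$ is the set of neighbors of $v$. $T_3(G)$ is the set of 3-element subsets of $V(G)$ inducing a connected subgraph of $G$. $G$ is strongly $T_3$-reconstructible if every finite, simple, connected labeled graph $H$ with $T_3(H) = T_3(G)$ is identical to $G$. The configurations (each requires the edge $uv$; "arbitrary" means that pair may or may not be adjacent): $\mathcal{F}_1$: vertices $u,v,v_1,v_2$; edges $uv_1, vv_2$; non-edges $vv_1, v_1v_2$; $uv_2$ arbitrary. $\mathcal{F}_2$: vertices $u,v,v_1,v_2$; edges $vv_1, vv_2$; non-edges $uv_1, uv_2$; $v_1v_2$ arbitrary. $\mathcal{F}_3$: vertices $u,v,v_1,v_2,v_3$; edges $uv_2, vv_3, v_2v_3, v_1v_2$; non-edges $vv_2, uv_1, vv_1, v_1v_3$; $uv_3$ arbitrary. $\mathcal{F}_4$: vertices $u,v,v_1,v_2,v_3$; edges $vv_1, v_1v_2, v_1v_3$; non-edges $uv_1, uv_2, uv_3, vv_2, vv_3$; $v_2v_3$ arbitrary. $\mathcal{F}_5$: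 vertices $u,v,v_1,v_2,v_3$ inducing the path $v\,u\,v_3\,v_2\,v_1$ (edges $uv, uv_3, v_3v_2, v_2v_1$ and no others among them). $\mathcal{F}_6$: vertices $u,v,v_1,v_2,v_3$; edges $uv_1, vv_3, v_1v_2, v_2v_3$; non-edges $vv_1, uv_3, uv_2, vv_2$; $v_1v_3$ arbitrary. *)

theory Defs
  imports "Graph_Theory.Graph_Theory"
begin

text \<open>
  Simple graphs are represented by symmetric loop-free digraphs without parallel arcs
  (the locale \<^locale>\<open>pair_graph\<close>, which includes finiteness). Such a graph is determined by its
  vertex set and its (symmetric) arc set, so two labeled graphs are identical iff the records
  are equal.
\<close>

definition connected_simple_graph :: "'a pair_pre_digraph \<Rightarrow> bool" where
  "connected_simple_graph G \<longleftrightarrow> pair_graph G \<and> Digraph_Component.connected (with_proj G)"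

definition T3 :: "'a pair_pre_digraph \<Rightarrow> 'a set set" where
  "T3 G = {S. S \<subseteq> pverts G \<and> card S = 3 \<and> Digraph_Component.connected (with_proj G \<restriction> S)}"

text \<open>
  Comparing only with graphs over the same label type loses nothing for graphs on at least three
  vertices: every vertex of a connected graph with at least three vertices lies in a member of
  \<^const>\<open>T3\<close>.
\<close>

definition strongly_T3_reconstructible :: "'a pair_pre_digraph \<Rightarrow> bool" where
  "strongly_T3_reconstructible G \<longleftrightarrow>
    (\<forall>H :: 'a pair_pre_digraph. connected_simple_graph H \<and> T3 H = T3 G \<longrightarrow> H = G)"

definition nbrs :: "'a pair_pre_digraph \<Rightarrow> 'a \<Rightarrow> 'a set" where
  "nbrs G v = {w \<in> pverts G. v \<rightarrow>\<^bsub>with_proj G\<^esub> w}"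

definition edge_in_triangle :: "'a pair_pre_digraph \<Rightarrow> 'a \<Rightarrow> 'a \<Rightarrow> bool" where
  "edge_in_triangle G u v \<longleftrightarrow> u \<rightarrow>\<^bsub>with_proj G\<^esub> v \<and>
    (\<exists>w \<in> pverts G. u \<rightarrow>\<^bsub>with_proj G\<^esub> w \<and> v \<rightarrow>\<^bsub>with_proj G\<^esub> w)"

definition distinct_vertices :: "'a pair_pre_digraph \<Rightarrow> 'a list \<Rightarrow> bool" where
  "distinct_vertices G xs \<longleftrightarrow> distinct xs \<and> set xs \<subseteq> pverts G"

text \<open>In the following configurations, pairs that are not mentioned may or may not be adjacent.\<close>

definition config_F1 :: "'a pair_pre_digraph \<Rightarrow> 'a \<Rightarrow> 'a \<Rightarrow> 'a \<Rightarrow> 'a \<Rightarrow> bool" where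
  "config_F1 G u v v1 v2 \<longleftrightarrow> distinct_vertices G [u, v, v1, v2] \<and>
    u \<rightarrow>\<^bsub>with_proj G\<^esub> v \<and> u \<rightarrow>\<^bsub>with_proj G\<^esub> v1 \<and> v \<rightarrow>\<^bsub>with_proj G\<^esub> v2 \<and>
    \<not> v \<rightarrow>\<^bsub>with_proj G\<^esub> v1 \<and> \<not> v1 \<rightarrow>\<^bsub>with_proj G\<^esub> v2"

definition config_F2 :: "'a pair_pre_digraph \<Rightarrow> 'a \<Rightarrow> 'a \<Rightarrow> 'a \<Rightarrow> 'a \<Rightarrow> bool" where
  "config_F2 G u v v1 v2 \<longleftrightarrow> distinct_vertices G [u, v, v1, v2] \<and>
    u \<rightarrow>\<^bsub>with_proj G\<^esub> v \<and> v \<rightarrow>\<^bsub>with_proj G\<^esub> v1 \<and> v \<rightarrow>\<^bsub>with_proj G\<^esub> v2 \<and>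
    \<not> u \<rightarrow>\<^bsub>with_proj G\<^esub> v1 \<and> \<not> u \<rightarrow>\<^bsub>with_proj G\<^esub> v2"

definition config_F3 :: "'a pair_pre_digraph \<Rightarrow> 'a \<Rightarrow> 'a \<Rightarrow> 'a \<Rightarrow> 'a \<Rightarrow> 'a \<Rightarrow> bool" where
  "config_F3 G u v v1 v2 v3 \<longleftrightarrow> distinct_vertices G [u, v, v1, v2, v3] \<and>
    u \<rightarrow>\<^bsub>with_proj G\<^esub> v \<and> u \<rightarrow>\<^bsub>with_proj G\<^esub> v2 \<and> v \<rightarrow>\<^bsub>with_proj G\<^esub> v3 \<and>
    v2 \<rightarrow>\<^bsub>with_proj G\<^esub> v3 \<and> v1 \<rightarrow>\<^bsub>with_proj G\<^esub> v2 \<and>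
    \<not> v \<rightarrow>\<^bsub>with_proj G\<^esub> v2 \<and> \<not> u \<rightarrow>\<^bsub>with_proj G\<^esub> v1 \<and>
    \<not> v \<rightarrow>\<^bsub>with_proj G\<^esub> v1 \<and> \<not> v1 \<rightarrow>\<^bsub>with_proj G\<^esub> v3"

definition config_F4 :: "'a pair_pre_digraph \<Rightarrow> 'a \<Rightarrow> 'a \<Rightarrow> 'a \<Rightarrow> 'a \<Rightarrow> 'a \<Rightarrow> bool" where
  "config_F4 G u v v1 v2 v3 \<longleftrightarrow> distinct_vertices G [u, v, v1, v2, v3] \<and>
    u \<rightarrow>\<^bsub>with_proj G\<^esub> v \<and> v \<rightarrow>\<^bsub>with_proj G\<^esub> v1 \<and>
    v1 \<rightarrow>\<^bsub>with_proj G\<^esub> v2 \<and> v1 \<rightarrow>\<^bsub>with_proj G\<^esub> v3 \<and>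
    \<not> u \<rightarrow>\<^bsub>with_proj G\<^esub> v1 \<and> \<not> u \<rightarrow>\<^bsub>with_proj G\<^esub> v2 \<and> \<not> u \<rightarrow>\<^bsub>with_proj G\<^esub> v3 \<and>
    \<not> v \<rightarrow>\<^bsub>with_proj G\<^esub> v2 \<and> \<not> v \<rightarrow>\<^bsub>with_proj G\<^esub> v3"

definition config_F5 :: "'a pair_pre_digraph \<Rightarrow> 'a \<Rightarrow> 'a \<Rightarrow> 'a \<Rightarrow> 'a \<Rightarrow> 'a \<Rightarrow> bool" where
  "config_F5 G u v v1 v2 v3 \<longleftrightarrow> distinct_vertices G [u, v, v1, v2, v3] \<and>
    u \<rightarrow>\<^bsub>with_proj G\<^esub> v \<and> u \<rightarrow>\<^bsub>with_proj G\<^esub> v3 \<and>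
    v3 \<rightarrow>\<^bsub>with_proj G\<^esub> v2 \<and> v2 \<rightarrow>\<^bsub>with_proj G\<^esub> v1 \<and>
    \<not> u \<rightarrow>\<^bsub>with_proj G\<^esub> v1 \<and> \<not> u \<rightarrow>\<^bsub>with_proj G\<^esub> v2 \<and>
    \<not> v \<rightarrow>\<^bsub>with_proj G\<^esub> v1 \<and> \<not> v \<rightarrow>\<^bsub>with_proj G\<^esub> v2 \<and> \<not> v \<rightarrow>\<^bsub>with_proj G\<^esub> v3 \<and>
    \<not> v1 \<rightarrow>\<^bsub>with_proj G\<^esub> v3"

definition config_F6 :: "'a pair_pre_digraph \<Rightarrow> 'a \<Rightarrow> 'a \<Rightarrow> 'a \<Rightarrow> 'a \<Rightarrow> 'a \<Rightarrow> bool" where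
  "config_F6 G u v v1 v2 v3 \<longleftrightarrow> distinct_vertices G [u, v, v1, v2, v3] \<and>
    u \<rightarrow>\<^bsub>with_proj G\<^esub> v \<and> u \<rightarrow>\<^bsub>with_proj G\<^esub> v1 \<and> v \<rightarrow>\<^bsub>with_proj G\<^esub> v3 \<and>
    v1 \<rightarrow>\<^bsub>with_proj G\<^esub> v2 \<and> v2 \<rightarrow>\<^bsub>with_proj G\<^esub> v3 \<and>
    \<not> v \<rightarrow>\<^bsub>with_proj G\<^esub> v1 \<and> \<not> u \<rightarrow>\<^bsub>with_proj G\<^esub> v3 \<and>
    \<not> u \<rightarrow>\<^bsub>with_proj G\<^esub> v2 \<and> \<not> v \<rightarrow>\<^bsub>with_proj G\<^esub> v2"

definition realizes_config :: "'a pair_pre_digraph \<Rightarrow> 'a \<Rightarrow> 'a \<Rightarrow> bool" where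
  "realizes_config G u v \<longleftrightarrow>
    (\<exists>v1 v2. config_F1 G u v v1 v2 \<or> config_F2 G u v v1 v2) \<or>
    (\<exists>v1 v2 v3. config_F3 G u v v1 v2 v3 \<or> config_F4 G u v v1 v2 v3 \<or>
       config_F5 G u v v1 v2 v3 \<or> config_F6 G u v v1 v2 v3)"

end

theory Submission
  imports Defs
begin

text \<open>
  A triple is connected iff it contains at least two edges, so for graphs \<open>G\<close>, \<open>H\<close> with the same
  \<^const>\<open>T3\<close> every triple has the same majority of edges versus non-edges in both. Consequently the
  pairs on which \<open>G\<close> and \<open>H\<close> differ form vertex-disjoint triangle-free paths and cycles whose pairs
  alternate between edges and non-edges of \<open>G\<close>, and a vertex that does not differ from either end of
  such a pair sees both ends alike. If \<open>G\<close> has no twins, some component must be a 4-cycle, with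
  exactly one diagonal an edge of \<open>G\<close>: its vertices induce a \<open>P4\<close> that is a module of \<open>G\<close>.
  Conversely, flipping the pair of two twins, or these four pairs of a \<open>P4\<close> module \<open>a b c d\<close>
  (which exchanges \<open>b\<close> and \<open>c\<close>), changes no majority. Finally, in a twin-free graph an edge that
  realizes no configuration is an end edge of a \<open>P4\<close> module, and an end edge of such a module
  realizes no configuration.
\<close>

subsection \<open>Triples and connectivity\<close>

text \<open>A walk from \<open>A\<close> to its complement must leave \<open>A\<close> at some step;
  conversely, no pair of \<open>r\<close> leaves, within \<open>S\<close>, the set reachable from
  \<open>u\<close>. Cuts make connectivity of a triple a finite check and transfer easily between
  graphs.\<close>

lemma rtrancl_on_total_iff_cut:
  "(\<forall>u\<in>S. \<forall>v\<in>S. (u, v) \<in> rtrancl_on S r) \<longleftrightarrow>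
    (\<forall>A. A \<subset> S \<and> A \<noteq> {} \<longrightarrow> (\<exists>x\<in>A. \<exists>y\<in>S - A. (x, y) \<in> r))" (is "?L \<longleftrightarrow> ?R")
proof
  assume L: ?L
  show ?R
  proof (intro allI impI, elim conjE)
    fix A assume A: "A \<subset> S" "A \<noteq> {}"
    then obtain u v where u: "u \<in> A" and v: "v \<in> S" "v \<notin> A" by blast
    then have "(u, v) \<in> rtrancl_on S r" using L A by blast
    then have "v \<in> A" if "\<not> (\<exists>x\<in>A. \<exists>y\<in>S - A. (x, y) \<in> r)"
      by (induct rule: rtrancl_on_induct) (use u that in auto)
    then show "\<exists>x\<in>A. \<exists>y\<in>S - A. (x, y) \<in> r" using v by blast
  qed
next
  assume R: ?R
  show ?L
  proof (intro ballI)
    fix u v assume uv: "u \<in> S" "v \<in> S"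
    let ?A = "{w \<in> S. (u, w) \<in> rtrancl_on S r}"
    have "?A = S"
    proof (rule ccontr)
      assume "?A \<noteq> S"
      then have "?A \<subset> S" "?A \<noteq> {}" using uv by auto
      from R[rule_format, OF conjI[OF this]] obtain x y
        where "(u, x) \<in> rtrancl_on S r" "(x, y) \<in> r" "y \<in> S" "(u, y) \<notin> rtrancl_on S r"
        by blast
      then show False using rtrancl_on_into_rtrancl_on by metis
    qed
    then show "(u, v) \<in> rtrancl_on S r" using uv by blast
  qed
qed

text \<open>Arcs are already symmetric, so symmetrizing adds none. \<open>S\<close> may contain
  points outside the vertex set, which lets triples be treated before their membership is
  known.\<close>

lemma connected_induce_iff_cut:
  assumes "pair_graph G"
  shows "Digraph_Component.connected (with_proj G \<restriction> S) \<longleftrightarrow> S \<noteq> {} \<and>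
    (\<forall>A. A \<subset> S \<and> A \<noteq> {} \<longrightarrow> (\<exists>x\<in>A. \<exists>y\<in>S - A. (x, y) \<in> parcs G))"
proof -
  interpret pair_graph G by fact
  have "parcs (mk_symmetric (with_proj G \<restriction> S)) = parcs G \<inter> S \<times> S"
    by (auto simp: parcs_mk_symmetric intro: arcs_symmetric)
  then have "Digraph_Component.connected (with_proj G \<restriction> S) \<longleftrightarrow> S \<noteq> {} \<and>
      (\<forall>u\<in>S. \<forall>v\<in>S. (u, v) \<in> rtrancl_on S (parcs G \<inter> S \<times> S))"
    by (simp add: connected_def strongly_connected_def reachable_def)
  then show ?thesis unfolding rtrancl_on_total_iff_cut by blast
qed

lemma connected_iff_cut:
  assumes "pair_graph G"
  shows "Digraph_Component.connected (with_proj G) \<longleftrightarrow> pverts G \<noteq> {} \<and>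
    (\<forall>A. A \<subset> pverts G \<and> A \<noteq> {} \<longrightarrow> (\<exists>x\<in>A. \<exists>y\<in>pverts G - A. (x, y) \<in> parcs G))"
proof -
  interpret pair_graph G by fact
  have "with_proj G \<restriction> pverts G = with_proj G"
    unfolding induce_subgraph_def by (auto simp: with_proj_def dest: in_arcsD1 in_arcsD2)
  then show ?thesis using connected_induce_iff_cut[OF assms, of "pverts G"] by simp
qed

text \<open>The majority function of the three pairs; it is invariant under permuting
  \<open>x\<close>, \<open>y\<close>, \<open>z\<close> when \<open>E\<close> is symmetric.\<close>

definition two_edges :: "'a rel \<Rightarrow> 'a \<Rightarrow> 'a \<Rightarrow> 'a \<Rightarrow> bool" where
  "two_edges E x y z \<longleftrightarrow>
    ((x, y) \<in> E \<and> (y, z) \<in> E) \<or> ((x, y) \<in> E \<and> (x, z) \<in> E) \<or> ((x, z) \<in> E \<and> (y, z) \<in> E)"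

definition same_triples :: "'a rel \<Rightarrow> 'a rel \<Rightarrow> bool" where
  "same_triples E F \<longleftrightarrow> (\<forall>x y z. distinct [x, y, z] \<longrightarrow> two_edges E x y z = two_edges F x y z)"

text \<open>A nonempty proper part of a triple is a singleton or the complement of one, so
  connectivity means that no vertex is isolated in the triple: one edge misses a vertex, two cover
  all three.\<close>

lemma connected_triple_iff:
  assumes "pair_graph G" "distinct [x, y, z]"
  shows "Digraph_Component.connected (with_proj G \<restriction> {x, y, z}) \<longleftrightarrow> two_edges (parcs G) x y z"
proof -
  interpret pair_graph G by fact
  note sym = arcs_symmetric
  have neq: "x \<noteq> y" "x \<noteq> z" "y \<noteq> z" using assms(2) by auto
  show ?thesis (is "?L \<longleftrightarrow> ?R")
  proof
    assume ?L
    then have cut: "\<exists>p\<in>A. \<exists>q\<in>{x, y, z} - A. (p, q) \<in> parcs G"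
      if "A \<subset> {x, y, z}" "A \<noteq> {}" for A
      using that connected_induce_iff_cut[OF assms(1)] by blast
    have "{x} \<subset> {x, y, z}" "{y} \<subset> {x, y, z}" "{z} \<subset> {x, y, z}" using neq by auto
    from cut[OF this(1)] cut[OF this(2)] cut[OF this(3)]
    show ?R unfolding two_edges_def using sym by blast
  next
    assume R: ?R
    have "\<exists>p\<in>A. \<exists>q\<in>{x, y, z} - A. (p, q) \<in> parcs G" if A: "A \<subset> {x, y, z}" "A \<noteq> {}" for A
    proof -
      have "\<not> (x \<in> A \<and> y \<in> A \<and> z \<in> A)" "x \<in> A \<or> y \<in> A \<or> z \<in> A" using A by auto
      then show ?thesis using R unfolding two_edges_def
        by (cases "x \<in> A"; cases "y \<in> A"; cases "z \<in> A") (auto intro: sym)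
    qed
    then show ?L unfolding connected_induce_iff_cut[OF assms(1)] by simp
  qed
qed

text \<open>Two edges on three vertices touch each of them, so membership in the vertex set comes
  for free.\<close>

lemma triple_in_T3_iff:
  assumes "pair_graph G" "distinct [x, y, z]"
  shows "{x, y, z} \<in> T3 G \<longleftrightarrow> two_edges (parcs G) x y z"
proof -
  interpret pair_graph G by fact
  have "two_edges (parcs G) x y z \<Longrightarrow> {x, y, z} \<subseteq> pverts G"
    unfolding two_edges_def by (auto dest: in_arcsD1 in_arcsD2)
  then show ?thesis
    using connected_triple_iff[OF assms] assms(2) by (auto simp: T3_def)
qed

lemma T3_eq_iff:
  assumes "pair_graph G" "pair_graph H"
  shows "T3 G = T3 H \<longleftrightarrow> same_triples (parcs G) (parcs H)"
proof
  assume "T3 G = T3 H"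
  then show "same_triples (parcs G) (parcs H)"
    unfolding same_triples_def using triple_in_T3_iff[OF assms(1)] triple_in_T3_iff[OF assms(2)]
    by blast
next
  assume same: "same_triples (parcs G) (parcs H)"
  have "S \<in> T3 G \<longleftrightarrow> S \<in> T3 H" for S
  proof (cases "card S = 3")
    case True
    then obtain x y z where S: "S = {x, y, z}" and d: "distinct [x, y, z]"
      unfolding card_3_iff by auto
    then show ?thesis
      using same triple_in_T3_iff[OF assms(1) d] triple_in_T3_iff[OF assms(2) d]
      unfolding same_triples_def by blast
  qed (simp add: T3_def)
  then show "T3 G = T3 H" by blast
qed

section \<open>Recovering the vertex set and connectedness from the triples\<close>

lemma ex_third_vertex_two_edges:
  assumes "connected_simple_graph G" "card (pverts G) \<ge> 3" "(x, y) \<in> parcs G"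
  obtains z where "distinct [x, y, z]" "two_edges (parcs G) x y z"
proof -
  have pg: "pair_graph G" and c: "Digraph_Component.connected (with_proj G)"
    using assms(1) by (auto simp: connected_simple_graph_def)
  interpret pair_graph G by fact
  have "card {x, y} \<le> 2" by (simp add: card_insert_if)
  then have "{x, y} \<noteq> pverts G" using assms(2) by auto
  then have "{x, y} \<subset> pverts G" using assms(3) by (auto dest: in_arcsD1 in_arcsD2)
  then obtain p z where pz: "p \<in> {x, y}" "z \<in> pverts G - {x, y}" "(p, z) \<in> parcs G"
    using c unfolding connected_iff_cut[OF pg] by blast
  show thesis
  proof (rule that[of z])
    show "distinct [x, y, z]" using pz no_loops'[OF assms(3)] by auto
    show "two_edges (parcs G) x y z" using pz assms(3) unfolding two_edges_def by auto
  qed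
qed

lemma ex_edge_at_vertex:
  assumes "connected_simple_graph G" "card (pverts G) \<ge> 3" "x \<in> pverts G"
  obtains y where "(x, y) \<in> parcs G"
proof -
  have pg: "pair_graph G" and c: "Digraph_Component.connected (with_proj G)"
    using assms(1) by (auto simp: connected_simple_graph_def)
  have "pverts G \<noteq> {x}" using assms(2) by auto
  then have "{x} \<subset> pverts G" using assms(3) by auto
  then show thesis using that c unfolding connected_iff_cut[OF pg] by blast
qed

text \<open>Every vertex lies on an edge and every edge extends to a connected triple, so the
  triples determine the vertex set.\<close>

lemma Union_T3:
  assumes "connected_simple_graph G" "card (pverts G) \<ge> 3"
  shows "\<Union>(T3 G) = pverts G"
proof
  show "\<Union>(T3 G) \<subseteq> pverts G" by (auto simp: T3_def)
  have pg: "pair_graph G" using assms(1) by (simp add: connected_simple_graph_def)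
  show "pverts G \<subseteq> \<Union>(T3 G)"
  proof
    fix x assume "x \<in> pverts G"
    then obtain y where xy: "(x, y) \<in> parcs G" using ex_edge_at_vertex[OF assms] by blast
    obtain z where "distinct [x, y, z]" "two_edges (parcs G) x y z"
      using ex_third_vertex_two_edges[OF assms xy] by blast
    then show "x \<in> \<Union>(T3 G)" using triple_in_T3_iff[OF pg] by blast
  qed
qed

text \<open>An edge of \<open>G\<close> across a cut lies in a connected triple. That triple is
  connected in \<open>H\<close> too and meets both sides, so one of its \<open>H\<close>-edges
  crosses the same cut.\<close>

lemma connected_if_same_triples:
  assumes G: "connected_simple_graph G" "card (pverts G) \<ge> 3"
    and H: "pair_graph H" "pverts H = pverts G" and same: "same_triples (parcs G) (parcs H)"
  shows "connected_simple_graph H"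
proof -
  have pg: "pair_graph G" and c: "Digraph_Component.connected (with_proj G)"
    using G(1) by (auto simp: connected_simple_graph_def)
  interpret G: pair_graph G by fact
  interpret H: pair_graph H by fact
  have "\<exists>p\<in>A. \<exists>q\<in>pverts G - A. (p, q) \<in> parcs H" if A: "A \<subset> pverts G" "A \<noteq> {}" for A
  proof -
    obtain x y where xy: "x \<in> A" "y \<in> pverts G - A" "(x, y) \<in> parcs G"
      using c A unfolding connected_iff_cut[OF pg] by blast
    obtain z where d: "distinct [x, y, z]" and t: "two_edges (parcs G) x y z"
      using ex_third_vertex_two_edges[OF G xy(3)] by blast
    then have tH: "two_edges (parcs H) x y z" using same unfolding same_triples_def by blast
    have "z \<in> pverts G"
      using t unfolding two_edges_def by (auto dest: G.in_arcsD1 G.in_arcsD2)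
    then show ?thesis
      using xy tH unfolding two_edges_def by (cases "z \<in> A") (auto intro: H.arcs_symmetric)
  qed
  then show ?thesis
    using c unfolding connected_simple_graph_def connected_iff_cut[OF pg] connected_iff_cut[OF H(1)]
    using H by auto
qed

lemma (in pair_graph) sym_parcs: "sym (parcs G)"
  using arcs_symmetric by (rule symI)

lemma (in pair_graph) irrefl_parcs: "irrefl (parcs G)"
  using no_loops' unfolding irrefl_def by blast

lemma (in pair_graph) parcs_subset: "parcs G \<subseteq> pverts G \<times> pverts G"
  by (auto dest: in_arcsD1 in_arcsD2)

text \<open>Since the triples fix the vertex set and pass on connectedness, quantifying over graphs
  \<open>H\<close> reduces to quantifying over edge relations on a fixed vertex set.\<close>

lemma strongly_T3_reconstructible_iff:
  assumes G: "connected_simple_graph G" "card (pverts G) \<ge> 3"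
  shows "strongly_T3_reconstructible G \<longleftrightarrow>
    (\<forall>F. sym F \<and> irrefl F \<and> F \<subseteq> pverts G \<times> pverts G \<and> same_triples (parcs G) F \<longrightarrow> F = parcs G)"
    (is "?L \<longleftrightarrow> ?R")
proof -
  have pg: "pair_graph G" using G(1) by (auto simp: connected_simple_graph_def)
  interpret pair_graph G by fact
  show ?thesis
  proof
    assume L: ?L
    show ?R
    proof (intro allI impI, elim conjE)
      fix F assume F: "sym F" "irrefl F" "F \<subseteq> pverts G \<times> pverts G" "same_triples (parcs G) F"
      let ?H = "\<lparr>pverts = pverts G, parcs = F\<rparr>"
      have "finite F" using F(3) finite_subset by fastforce
      then have pH: "pair_graph ?H"
        using F(1-3) by unfold_locales (auto simp: symmetric_def irrefl_def)
      then have "connected_simple_graph ?H"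
        using connected_if_same_triples[OF G pH] F(4) by simp
      moreover have "T3 ?H = T3 G" using T3_eq_iff[OF pg pH] F(4) by simp
      ultimately have "?H = G" using L unfolding strongly_T3_reconstructible_def by blast
      then show "F = parcs G" by (metis pair_pre_digraph.select_convs(2))
    qed
  next
    assume R: ?R
    show ?L unfolding strongly_T3_reconstructible_def
    proof (intro allI impI, elim conjE)
      fix H :: "'a pair_pre_digraph"
      assume H: "connected_simple_graph H" "T3 H = T3 G"
      then have pH: "pair_graph H" by (simp add: connected_simple_graph_def)
      interpret H: pair_graph H by fact
      \<comment> \<open>\<open>H\<close> must first be seen to have three vertices before its vertex
        set can be read off from its triples.\<close>
      have "\<Union>(T3 H) \<subseteq> pverts H" by (auto simp: T3_def)
      then have "pverts G \<subseteq> pverts H" using Union_T3[OF G] H(2) by simp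
      then have "card (pverts H) \<ge> 3"
        using le_trans[OF G(2) card_mono[OF H.pair_finite_verts]] by simp
      then have V: "pverts H = pverts G" using Union_T3[OF G] Union_T3[OF H(1)] H(2) by simp
      have "same_triples (parcs G) (parcs H)" using T3_eq_iff[OF pg pH] H(2) by simp
      moreover note H.sym_parcs H.irrefl_parcs
      moreover have "parcs H \<subseteq> pverts G \<times> pverts G"
        using V H.parcs_subset by simp
      ultimately have "parcs H = parcs G" using R by blast
      then show "H = G" using V by simp
    qed
  qed
qed

subsection \<open>Differing pairs\<close>

text \<open>Covers adjacent and non-adjacent twins alike. For an arc set, \<open>x\<close> may range
  over the whole type, as points outside the graph are adjacent to nothing.\<close>

definition twins :: "'a rel \<Rightarrow> 'a \<Rightarrow> 'a \<Rightarrow> bool" where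
  "twins E a b \<longleftrightarrow> a \<noteq> b \<and> (\<forall>x. x \<noteq> a \<and> x \<noteq> b \<longrightarrow> (a, x) \<in> E \<longleftrightarrow> (b, x) \<in> E)"

definition P4_module :: "'a rel \<Rightarrow> 'a \<Rightarrow> 'a \<Rightarrow> 'a \<Rightarrow> 'a \<Rightarrow> bool" where
  "P4_module E a b c d \<longleftrightarrow> distinct [a, b, c, d] \<and>
    (a, b) \<in> E \<and> (b, c) \<in> E \<and> (c, d) \<in> E \<and> (a, c) \<notin> E \<and> (a, d) \<notin> E \<and> (b, d) \<notin> E \<and>
    (\<forall>x. x \<notin> {a, b, c, d} \<longrightarrow>
      ((a, x) \<in> E \<longleftrightarrow> (b, x) \<in> E) \<and> ((b, x) \<in> E \<longleftrightarrow> (c, x) \<in> E) \<and> ((c, x) \<in> E \<longleftrightarrow> (d, x) \<in> E))"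

locale same_triples_pair =
  fixes E F :: "'a rel"
  assumes sym_E: "sym E" and irrefl_E: "irrefl E" and sym_F: "sym F" and irrefl_F: "irrefl F"
    and same: "same_triples E F"
begin

definition differ :: "'a \<Rightarrow> 'a \<Rightarrow> bool" where
  "differ x y \<longleftrightarrow> ((x, y) \<in> E) \<noteq> ((x, y) \<in> F)"

lemma adj_sym: "(x, y) \<in> E \<longleftrightarrow> (y, x) \<in> E" "(x, y) \<in> F \<longleftrightarrow> (y, x) \<in> F"
  using sym_E sym_F by (meson symD)+

lemma differ_sym: "differ x y \<longleftrightarrow> differ y x"
  unfolding differ_def using adj_sym by blast

lemma differ_neq: "differ x y \<Longrightarrow> x \<noteq> y"
  using irrefl_E irrefl_F by (auto simp: differ_def irrefl_def)

text \<open>Two pairs changing in the same direction would reverse the majority. Changing in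
  opposite directions they cancel, so the third pair decides the majority in both graphs and cannot
  change.\<close>

lemma differ_alternates:
  assumes "differ a b" "differ a c" "b \<noteq> c"
  shows "\<not> differ b c" "(a, b) \<in> E \<longleftrightarrow> (a, c) \<notin> E"
proof -
  have "distinct [a, b, c]" using assms differ_neq by auto
  then have "two_edges E a b c = two_edges F a b c" using same by (simp add: same_triples_def)
  then show "\<not> differ b c" "(a, b) \<in> E \<longleftrightarrow> (a, c) \<notin> E"
    using assms by (auto simp: two_edges_def differ_def)
qed

text \<open>Differing pairs at \<open>a\<close> must have pairwise different status in
  \<open>E\<close>, and there are only two statuses.\<close>

lemma differ_at_most_two:
  assumes "differ a b" "differ a c" "differ a d" "b \<noteq> c" "d \<noteq> b"
  shows "d = c"
  using assms differ_alternates(2)[of a b c] differ_alternates(2)[of a b d]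
    differ_alternates(2)[of a c d] by auto

text \<open>If only one pair of a triple changes, the majority survives only when the other two
  pairs agree.\<close>

lemma differ_homogeneous:
  assumes "differ a b" "\<not> differ a x" "\<not> differ b x" "x \<noteq> a" "x \<noteq> b"
  shows "(a, x) \<in> E \<longleftrightarrow> (b, x) \<in> E"
proof -
  have "distinct [a, b, x]" using assms differ_neq by auto
  then have "two_edges E a b x = two_edges F a b x" using same by (simp add: same_triples_def)
  then show ?thesis using assms by (auto simp: two_edges_def differ_def)
qed

text \<open>
  If no differing 4-cycle existed, this lemma, read along a differing path of length two in both
  directions, would make its chord agree with both of its two pairs, which alternate.
\<close>

lemma differ_path_chord:
  assumes no_twins: "\<And>a b. differ a b \<Longrightarrow> \<not> twins E a b"
    and p: "differ a b" "differ b c" "a \<noteq> c"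
    and no_cycle: "\<And>d. differ c d \<Longrightarrow> differ d a \<Longrightarrow> d = b"
  shows "(a, c) \<in> E \<longleftrightarrow> (b, c) \<in> E"
proof -
  obtain d where d: "d \<noteq> b" "d \<noteq> c" and neq: "(b, d) \<in> E \<longleftrightarrow> (c, d) \<notin> E"
    using no_twins[OF p(2)] differ_neq[OF p(2)] unfolding twins_def by blast
  have chord: "\<not> differ a c" and alt: "(a, b) \<in> E \<longleftrightarrow> (b, c) \<notin> E"
    using differ_alternates[of b a c] p adj_sym(1) differ_sym by blast+
  show ?thesis
  proof (cases "differ b d")
    case True
    \<comment> \<open>Both differing partners of \<open>b\<close> are known, so the vertex telling
      \<open>b\<close> and \<open>c\<close> apart is \<open>a\<close> itself.\<close>
    then have "d = a" using differ_at_most_two[of b c a d] p d differ_sym by blast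
    then show ?thesis using neq alt adj_sym(1) by blast
  next
    case False
    then have cd: "differ c d" using differ_homogeneous[OF p(2)] neq d by blast
    then have "\<not> differ a d" "(c, d) \<in> E \<longleftrightarrow> (c, b) \<notin> E"
      using no_cycle d differ_alternates(2)[of c d b] p differ_sym by blast+
    moreover have "d \<noteq> a" using cd chord differ_sym by blast
    \<comment> \<open>The chord \<open>a c\<close> has the status of \<open>a d\<close>, hence of
      \<open>b d\<close>; this is opposite to \<open>c d\<close>, which is opposite to
      \<open>c b\<close>.\<close>
    ultimately have "(a, d) \<in> E \<longleftrightarrow> (b, d) \<in> E" "(c, a) \<in> E \<longleftrightarrow> (d, a) \<in> E"
      using differ_homogeneous[OF p(1), of d] differ_homogeneous[OF cd, of a]
        False chord d p differ_sym by blast+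
    then show ?thesis
      using neq \<open>(c, d) \<in> E \<longleftrightarrow> (c, b) \<notin> E\<close> adj_sym(1) by blast
  qed
qed

text \<open>A vertex telling the ends of a differing pair apart must differ from one of them, which
  yields a differing path of length two. Unless it closes to a 4-cycle, its chord agrees with both
  of its alternating pairs.\<close>

lemma ex_differ_cycle:
  assumes no_twins: "\<And>a b. differ a b \<Longrightarrow> \<not> twins E a b" and "differ p q"
  obtains a b c d where "differ a b" "differ b c" "differ c d" "differ d a" "a \<noteq> c" "b \<noteq> d"
proof -
  note found = that
  obtain x where x: "x \<noteq> p" "x \<noteq> q" "(p, x) \<in> E \<longleftrightarrow> (q, x) \<notin> E"
    using no_twins[OF assms(2)] differ_neq[OF assms(2)] unfolding twins_def by blast
  then have "differ p x \<or> differ q x" using differ_homogeneous[OF assms(2)] by blast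
  then obtain a b c where abc: "differ a b" "differ b c" "a \<noteq> c"
    using x assms(2) differ_sym by metis
  then have alt: "(b, a) \<in> E \<longleftrightarrow> (b, c) \<notin> E" using differ_alternates(2) differ_sym by blast
  show thesis
  proof (rule ccontr)
    assume not_thesis: "\<not> thesis"
    have "d = b" if "differ c d" "differ d a" for d
      using not_thesis found[OF abc(1,2) that abc(3)] by blast
    then have "(a, c) \<in> E \<longleftrightarrow> (b, c) \<in> E" "(c, a) \<in> E \<longleftrightarrow> (b, a) \<in> E"
      using differ_path_chord[OF no_twins abc] differ_path_chord[OF no_twins, of c b a] abc
        differ_sym by blast+
    then show False using alt adj_sym(1) by blast
  qed
qed

lemma P4_module_if_differ_cycle:
  assumes no_twins: "\<And>a b. differ a b \<Longrightarrow> \<not> twins E a b"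
    and cyc: "differ a b" "differ b c" "differ c d" "differ d a" "a \<noteq> c" "b \<noteq> d"
    and ab: "(a, b) \<in> E"
  shows "P4_module E b a c d \<or> P4_module E a b d c"
proof -
  have neq: "distinct [a, b, c, d]" using cyc differ_neq by auto
  have bc: "(b, c) \<notin> E" and cd: "(c, d) \<in> E" and da: "(d, a) \<notin> E"
    using differ_alternates(2)[of b a c] differ_alternates(2)[of c b d]
      differ_alternates(2)[of a b d] cyc ab adj_sym(1) differ_sym by blast+
  \<comment> \<open>Each vertex of the cycle already has its two differing partners on the cycle, so
    outside vertices see all four vertices alike.\<close>
  have nbrs: "x \<in> {a, b, c, d}"
    if "differ a x \<or> differ b x \<or> differ c x \<or> differ d x" for x
    using that cyc differ_sym differ_at_most_two[of a b d x] differ_at_most_two[of b a c x]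
      differ_at_most_two[of c b d x] differ_at_most_two[of d a c x] by blast
  have out: "((a, x) \<in> E \<longleftrightarrow> (b, x) \<in> E) \<and> ((b, x) \<in> E \<longleftrightarrow> (c, x) \<in> E) \<and> ((c, x) \<in> E \<longleftrightarrow> (d, x) \<in> E)"
    if "x \<notin> {a, b, c, d}" for x
    using that nbrs[of x] cyc(1-3)[THEN differ_homogeneous, of x] by blast
  \<comment> \<open>Only the diagonals are still open: with both present \<open>b\<close> and
    \<open>c\<close> would be twins, with neither \<open>a\<close> and \<open>b\<close> would
    be.\<close>
  have "\<not> twins E a b" "\<not> twins E b c" using cyc no_twins by blast+
  then obtain x y where xy: "x \<notin> {a, b}" "(a, x) \<in> E \<longleftrightarrow> (b, x) \<notin> E"
    "y \<notin> {b, c}" "(b, y) \<in> E \<longleftrightarrow> (c, y) \<notin> E"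
    unfolding twins_def using neq by auto
  then have "x = c \<or> x = d" "y = a \<or> y = d" using out[of x] out[of y] by blast+
  then have "(a, c) \<in> E \<longleftrightarrow> (b, d) \<notin> E"
    using xy ab bc cd da adj_sym(1) by metis
  then show ?thesis
    unfolding P4_module_def using neq ab bc cd da out adj_sym(1) 
    by (cases "(a, c) \<in> E") auto
qed

lemma ex_P4_module:
  assumes no_twins: "\<And>a b. differ a b \<Longrightarrow> \<not> twins E a b" and "E \<noteq> F"
  obtains a b c d where "P4_module E a b c d"
proof -
  obtain p q where "differ p q" using assms(2) unfolding differ_def by auto
  then obtain a b c d where
    cyc: "differ a b" "differ b c" "differ c d" "differ d a" "a \<noteq> c" "b \<noteq> d"
    using ex_differ_cycle[OF no_twins] by metis
  show thesis
  proof (cases "(a, b) \<in> E")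
    case True
    then show thesis using P4_module_if_differ_cycle[OF no_twins cyc] that by blast
  next
    case False
    \<comment> \<open>By alternation the next pair is an edge, so the cycle is read starting from
      \<open>b\<close>.\<close>
    then have "(b, c) \<in> E" using differ_alternates(2)[of b a c] cyc adj_sym(1) differ_sym by blast
    then show thesis
      using P4_module_if_differ_cycle[OF no_twins cyc(2,3,4,1) cyc(6)] cyc(5) that by blast
  qed
qed

end

section \<open>Flipping pairs without changing any majority\<close>

definition flip :: "'a rel \<Rightarrow> 'a rel \<Rightarrow> 'a rel" where
  "flip E Q = {(x, y). ((x, y) \<in> E) \<noteq> ((x, y) \<in> Q \<or> (y, x) \<in> Q)}"

lemma sym_flip:
  assumes "sym E"
  shows "sym (flip E Q)"
  using assms unfolding sym_def flip_def by blast

lemma irrefl_flip: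
  assumes "irrefl E" "irrefl Q"
  shows "irrefl (flip E Q)"
  using assms unfolding irrefl_def flip_def by blast

lemma flip_neq:
  assumes "Q \<noteq> {}"
  shows "flip E Q \<noteq> E"
  using assms unfolding flip_def by auto

text \<open>A triple without a pair of \<open>Q\<close> is untouched; any other can be permuted so
  that such a pair comes first.\<close>

lemma same_triples_flip:
  assumes "sym E"
    and Q: "\<And>x y z. (x, y) \<in> Q \<Longrightarrow> z \<noteq> x \<Longrightarrow> z \<noteq> y \<Longrightarrow>
      two_edges E x y z = two_edges (flip E Q) x y z"
  shows "same_triples E (flip E Q)"
proof -
  have perm: "two_edges R x y z = two_edges R y x z" "two_edges R x y z = two_edges R x z y"
    if "sym R" for R and x y z :: 'a
    using symD[OF that] unfolding two_edges_def by blast+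
  have base: "two_edges E x y z = two_edges (flip E Q) x y z"
    if "(x, y) \<in> Q \<or> (y, x) \<in> Q" "distinct [x, y, z]" for x y z
    using that Q[of x y z] Q[of y x z] perm(1)[OF assms(1)] perm(1)[OF sym_flip[OF assms(1)]]
    by (metis distinct_length_2_or_more)
  show ?thesis unfolding same_triples_def
  proof (intro allI impI)
    fix x y z :: 'a assume d: "distinct [x, y, z]"
    show "two_edges E x y z = two_edges (flip E Q) x y z"
    proof (cases "\<exists>u v. u \<in> {x, y, z} \<and> v \<in> {x, y, z} \<and> u \<noteq> v \<and> (u, v) \<in> Q")
      case True
      then have "((x, y) \<in> Q \<or> (y, x) \<in> Q) \<or> ((x, z) \<in> Q \<or> (z, x) \<in> Q) \<or> ((y, z) \<in> Q \<or> (z, y) \<in> Q)"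
        by blast
      then show ?thesis
        using base[of x y z] base[of x z y] base[of y z x] d
          perm(1,2)[OF assms(1), of x y z] perm(2)[OF assms(1), of y x z]
          perm(1,2)[OF sym_flip[OF assms(1), of Q], of x y z]
          perm(2)[OF sym_flip[OF assms(1), of Q], of y x z] by auto
    next
      case False
      then have "\<And>u v. u \<in> {x, y, z} \<Longrightarrow> v \<in> {x, y, z} \<Longrightarrow> u \<noteq> v \<Longrightarrow> (u, v) \<in> flip E Q \<longleftrightarrow> (u, v) \<in> E"
        unfolding flip_def by blast
      then show ?thesis using d unfolding two_edges_def by simp
    qed
  qed
qed

text \<open>A third vertex sees the twins alike, and these two equal pairs already decide the
  majority.\<close>

lemma same_triples_flip_twins:
  assumes "sym E" "twins E a b"
  shows "same_triples E (flip E {(a, b)})"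
proof (rule same_triples_flip[OF assms(1)])
  fix x y z assume "(x, y) \<in> {(a, b)}" "z \<noteq> x" "z \<noteq> y"
  then show "two_edges E x y z = two_edges (flip E {(a, b)}) x y z"
    using assms(2) unfolding twins_def two_edges_def flip_def by auto
qed

text \<open>All pairs of the four vertices except \<open>b c\<close> and \<open>a d\<close>;
  flipping them turns the path \<open>a b c d\<close> into \<open>a c b d\<close>.\<close>

definition P4_module_pairs :: "'a \<Rightarrow> 'a \<Rightarrow> 'a \<Rightarrow> 'a \<Rightarrow> 'a rel" where
  "P4_module_pairs a b c d = {(a, b), (a, c), (b, d), (c, d)}"

text \<open>A triple inside the module loses one edge and gains one. With \<open>z\<close> outside,
  the two pairs at \<open>z\<close> agree and decide the majority.\<close>

lemma same_triples_flip_P4_module: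
  assumes "sym E" "P4_module E a b c d"
  shows "same_triples E (flip E (P4_module_pairs a b c d))"
proof (rule same_triples_flip[OF assms(1)])
  fix x y z assume xy: "(x, y) \<in> P4_module_pairs a b c d" and z: "z \<noteq> x" "z \<noteq> y"
  have neq: "a \<noteq> b" "a \<noteq> c" "a \<noteq> d" "b \<noteq> c" "b \<noteq> d" "c \<noteq> d"
    and adj: "(a, b) \<in> E" "(b, c) \<in> E" "(c, d) \<in> E" "(a, c) \<notin> E" "(a, d) \<notin> E" "(b, d) \<notin> E"
    using assms(2) unfolding P4_module_def by auto
  have s: "(b, a) \<in> E" "(c, b) \<in> E" "(d, c) \<in> E" "(c, a) \<notin> E" "(d, a) \<notin> E" "(d, b) \<notin> E"
    using adj symD[OF assms(1)] by blast+
  show "two_edges E x y z = two_edges (flip E (P4_module_pairs a b c d)) x y z"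
  proof (cases "z \<in> {a, b, c, d}")
    case True
    then show ?thesis
      using xy z neq adj s unfolding P4_module_pairs_def two_edges_def flip_def by auto
  next
    case False
    then have "((a, z) \<in> E \<longleftrightarrow> (b, z) \<in> E) \<and> ((b, z) \<in> E \<longleftrightarrow> (c, z) \<in> E) \<and> ((c, z) \<in> E \<longleftrightarrow> (d, z) \<in> E)"
      using assms(2) unfolding P4_module_def by blast
    then show ?thesis
      using False xy neq adj s unfolding P4_module_pairs_def two_edges_def flip_def by auto
  qed
qed

subsection \<open>Configurations and modules\<close>

lemma (in pair_graph) nbrs_minus_eq_iff_twins:
  assumes "a \<noteq> b"
  shows "nbrs G a - {b} = nbrs G b - {a} \<longleftrightarrow> twins (parcs G) a b"
proof -
  have nbrs: "nbrs G y = {x. (y, x) \<in> parcs G}" for y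
    by (auto simp: nbrs_def dest: in_arcsD2)
  have "(a, a) \<notin> parcs G" "(b, b) \<notin> parcs G" using no_loops' by blast+
  then show ?thesis using assms unfolding twins_def nbrs by auto
qed

text \<open>Neighbourhoods along the path are nearly nested: \<open>c\<close> is the only other
  neighbour of \<open>b\<close> missed by \<open>a\<close>, and \<open>d\<close> the only other
  neighbour of \<open>c\<close> missed by \<open>b\<close>. This leaves too few vertices for any
  configuration.\<close>

lemma (in pair_graph) no_config_if_P4_module:
  assumes "P4_module (parcs G) a b c d"
  shows "\<not> realizes_config G a b" "\<not> realizes_config G b a"
proof -
  let ?E = "parcs G"
  have neq: "distinct [a, b, c, d]"
    and adj: "(a, b) \<in> ?E" "(b, c) \<in> ?E" "(c, d) \<in> ?E" "(a, c) \<notin> ?E" "(a, d) \<notin> ?E" "(b, d) \<notin> ?E"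
    using assms unfolding P4_module_def by auto
  have s: "(x, y) \<in> ?E \<longleftrightarrow> (y, x) \<in> ?E" for x y using arcs_symmetric by blast
  have out: "((a, x) \<in> ?E \<longleftrightarrow> (b, x) \<in> ?E) \<and> ((b, x) \<in> ?E \<longleftrightarrow> (c, x) \<in> ?E) \<and> ((c, x) \<in> ?E \<longleftrightarrow> (d, x) \<in> ?E)"
    if "x \<noteq> a" "x \<noteq> b" "x \<noteq> c" "x \<noteq> d" for x
    using assms that unfolding P4_module_def by auto
  \<comment> \<open>A neighbour of \<open>a\<close> other than \<open>b\<close> lies outside the
    module and is thus adjacent to all four vertices.\<close>
  have ab: "(b, x) \<in> ?E" if "(a, x) \<in> ?E" "x \<noteq> b" for x
    using that adj out[of x] no_loops'[of a x] by blast
  have ac: "(c, x) \<in> ?E" if "(a, x) \<in> ?E" "x \<noteq> b" for x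
    using that adj out[of x] no_loops'[of a x] by blast
  have ad: "(d, x) \<in> ?E" if "(a, x) \<in> ?E" "x \<noteq> b" for x
    using that adj out[of x] no_loops'[of a x] by blast
  have c: "x = c" if "(b, x) \<in> ?E" "(a, x) \<notin> ?E" "x \<noteq> a" for x
    using that adj out[of x] no_loops'[of b x] by blast
  have d: "x = d" if "(c, x) \<in> ?E" "(b, x) \<notin> ?E" "x \<noteq> b" for x
    using that adj s out[of x] no_loops'[of c x] by blast
  have dc: "(c, x) \<in> ?E" if "(d, x) \<in> ?E" "x \<noteq> c" for x
    using that adj s out[of x] no_loops'[of d x] by blast
  note defs = config_F1_def config_F2_def config_F3_def config_F4_def config_F5_def config_F6_def
    distinct_vertices_def with_proj_simps
  \<comment> \<open>F1, F3, F5 and F6 ask for a neighbour of \<open>a\<close> missed by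
    \<open>b\<close>; F2 needs two vertices in the place of \<open>c\<close>, and F4 two in the
    place of \<open>d\<close>.\<close>
  have
    "\<not> config_F1 G a b v1 v2" "\<not> config_F2 G a b v1 v2" "\<not> config_F3 G a b v1 v2 v3"
    "\<not> config_F4 G a b v1 v2 v3" "\<not> config_F5 G a b v1 v2 v3" "\<not> config_F6 G a b v1 v2 v3"
    for v1 v2 v3
    subgoal unfolding defs using ab[of v1] by auto
    subgoal unfolding defs using c[of v1] c[of v2] by auto
    subgoal unfolding defs using ab[of v2] by auto
    subgoal unfolding defs using c[of v1] d[of v2] d[of v3] by auto
    subgoal unfolding defs using ab[of v3] by auto
    subgoal unfolding defs using ab[of v1] by auto
    done
  then show "\<not> realizes_config G a b" unfolding realizes_config_def by blast
  \<comment> \<open>F2, F4 and F6 again ask for a neighbour of \<open>a\<close> missed by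
    \<open>b\<close>. The others force \<open>c\<close>, and then possibly \<open>d\<close>, into
    place, and demand a non-edge that the module excludes.\<close>
  have
    "\<not> config_F1 G b a v1 v2" "\<not> config_F2 G b a v1 v2" "\<not> config_F3 G b a v1 v2 v3"
    "\<not> config_F4 G b a v1 v2 v3" "\<not> config_F5 G b a v1 v2 v3" "\<not> config_F6 G b a v1 v2 v3"
    for v1 v2 v3
    subgoal unfolding defs using c[of v1] ac[of v2] by auto
    subgoal unfolding defs using ab[of v1] by auto
    subgoal unfolding defs using c[of v2] d[of v1] ad[of v3] s[of v1 v2] by auto
    subgoal unfolding defs using ab[of v1] by auto
    subgoal unfolding defs using c[of v3] d[of v2] dc[of v1] s[of v1 v3] by auto
    subgoal unfolding defs using ab[of v3] by auto
    done
  then show "\<not> realizes_config G b a" unfolding realizes_config_def by blast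
qed

text \<open>The module grows from the edge: \<open>p\<close> is a neighbour of \<open>v\<close>
  missed by \<open>u\<close>, and \<open>q\<close> tells \<open>u\<close> and \<open>p\<close>
  apart. Each excluded configuration settles one remaining adjacency.\<close>

lemma (in pair_graph) P4_module_if_no_config_private:
  assumes no_twins: "\<And>a b. a \<in> pverts G \<Longrightarrow> b \<in> pverts G \<Longrightarrow> \<not> twins (parcs G) a b"
    and no_config: "\<not> realizes_config G u v" "\<not> realizes_config G v u"
    and uv: "(u, v) \<in> parcs G" and p: "(v, p) \<in> parcs G" "(u, p) \<notin> parcs G" "p \<noteq> u"
  shows "\<exists>q. P4_module (parcs G) u v p q"
proof -
  let ?E = "parcs G"
  have s: "(x, y) \<in> ?E \<longleftrightarrow> (y, x) \<in> ?E" for x y using arcs_symmetric by blast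
  have loop: "(x, x) \<notin> ?E" for x using no_loops' by blast
  have vert: "x \<in> pverts G" "y \<in> pverts G" if "(x, y) \<in> ?E" for x y
    using that in_arcsD1 in_arcsD2 by blast+
  note defs = config_F1_def config_F2_def config_F3_def config_F4_def config_F5_def config_F6_def
    distinct_vertices_def with_proj_simps
  have F:
    "\<not> config_F1 G u v v1 v2" "\<not> config_F2 G u v v1 v2" "\<not> config_F4 G u v v1 v2 v3"
    "\<not> config_F6 G u v v1 v2 v3" "\<not> config_F1 G v u v1 v2" "\<not> config_F2 G v u v1 v2"
    "\<not> config_F3 G v u v1 v2 v3" "\<not> config_F5 G v u v1 v2 v3"
    for v1 v2 v3
    using no_config unfolding realizes_config_def by blast+
  have neq: "u \<noteq> v" "p \<noteq> v" "p \<noteq> u" using uv p loop by auto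
  have V: "u \<in> pverts G" "v \<in> pverts G" "p \<in> pverts G" using uv p vert by blast+
  have vu: "(v, u) \<in> ?E" "(p, v) \<in> ?E" "(p, u) \<notin> ?E" using uv p s by blast+
  \<comment> \<open>A second such neighbour of \<open>v\<close> would realize F2.\<close>
  have private_v: "x = p" if "(v, x) \<in> ?E" "(u, x) \<notin> ?E" "x \<noteq> u" for x
    using F(2)[of p x] that p uv neq V vert[OF that(1)] loop[of v] unfolding defs by auto
  \<comment> \<open>Otherwise F1 arises with the roles of \<open>u\<close> and \<open>v\<close>
    exchanged.\<close>
  have common_p: "(p, x) \<in> ?E" if "(u, x) \<in> ?E" "(v, x) \<in> ?E" for x
    using F(5)[of p x] that p vu uv neq V vert[OF that(1)] loop[of u] loop[of v]
    unfolding defs by auto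
  obtain q where q: "q \<noteq> u" "q \<noteq> p" "(u, q) \<in> ?E \<longleftrightarrow> (p, q) \<notin> ?E"
    using no_twins[of u p] V neq unfolding twins_def by blast
  have no_private_u: "(v, r) \<in> ?E" if ur: "(u, r) \<in> ?E" "r \<noteq> v" for r
  proof (rule ccontr)
    assume vr: "(v, r) \<notin> ?E"
    have r: "r \<noteq> u" "r \<noteq> p" "r \<in> pverts G" using ur p loop vert by auto
    have rp: "(r, p) \<in> ?E"
      using F(1)[of r p] ur vr r uv p neq V unfolding defs by auto
    have private_u: "x = r" if "(u, x) \<in> ?E" "(v, x) \<notin> ?E" "x \<noteq> v" for x
      using F(6)[of r x] that ur vr vu r neq V vert[OF that(1)] loop[of u] unfolding defs by auto
    have "(p, q) \<in> ?E" if "(u, q) \<in> ?E"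
      using that private_u[of q] common_p[of q] rp vu s by blast
    then have pq: "(p, q) \<in> ?E" "(u, q) \<notin> ?E" using q by blast+
    then have vq: "q \<noteq> v" "(v, q) \<notin> ?E" "q \<noteq> r" "q \<in> pverts G"
      using private_v[of q] q uv ur vert by blast+
    \<comment> \<open>Here \<open>u v p r\<close> is a 4-cycle without chords, and \<open>q\<close>
      is adjacent to \<open>p\<close> but to neither \<open>u\<close> nor \<open>v\<close>: F6 if
      \<open>q\<close> is adjacent to \<open>r\<close>, F3 with exchanged roles if not.\<close>
    show False
    proof (cases "(r, q) \<in> ?E")
      case True
      then show False
        using F(4)[of r q p] s[of q p] pq vq q r ur vr uv p neq V unfolding defs by auto
    next
      case False
      then show False
        using F(7)[of q p r] s[of q p] s[of q r] s[of p r] pq vq q r rp ur vu p neq V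
        unfolding defs by auto
    qed
  qed
  have pq: "(p, q) \<in> ?E" "(u, q) \<notin> ?E"
    using q common_p[of q] no_private_u[of q] vu by blast+
  then have vq: "q \<noteq> v" "(v, q) \<notin> ?E" "q \<in> pverts G"
    using private_v[of q] q uv vert by blast+
  have out: "((u, x) \<in> ?E \<longleftrightarrow> (v, x) \<in> ?E) \<and> ((v, x) \<in> ?E \<longleftrightarrow> (p, x) \<in> ?E) \<and> ((p, x) \<in> ?E \<longleftrightarrow> (q, x) \<in> ?E)"
    if x: "x \<notin> {u, v, p, q}" for x
  proof (cases "(u, x) \<in> ?E")
    case True
    then have "(v, x) \<in> ?E" "(p, x) \<in> ?E" "x \<in> pverts G"
      using no_private_u common_p x vert by blast+
    \<comment> \<open>If \<open>q\<close> missed \<open>x\<close>, then \<open>x\<close> would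
      complete F3 with exchanged roles.\<close>
    moreover have "(q, x) \<in> ?E"
      using F(7)[of q p x] s[of q p] True calculation x pq vq q p vu neq V unfolding defs by auto
    ultimately show ?thesis using True by blast
  next
    case False
    then have vx: "(v, x) \<notin> ?E" using private_v x by blast
    \<comment> \<open>Two such neighbours \<open>q\<close> and \<open>x\<close> of \<open>p\<close>
      would realize F4.\<close>
    have px: "(p, x) \<notin> ?E"
      using F(3)[of p q x] False vx x pq vq q p uv neq V vert[of p x] unfolding defs by auto
    \<comment> \<open>Otherwise \<open>u v p q x\<close> is an induced path, which is F5 with
      exchanged roles.\<close>
    have "(q, x) \<notin> ?E"
      using F(8)[of x q p] s[of x p] False vx px x pq vq q p vu neq V vert[of q x]
      unfolding defs by auto
    then show ?thesis using False vx px by blast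
  qed
  have "P4_module ?E u v p q"
    unfolding P4_module_def using out neq q p uv pq vq by auto
  then show ?thesis by blast
qed

lemma (in pair_graph) ex_P4_module_if_no_config:
  assumes no_twins: "\<And>a b. a \<in> pverts G \<Longrightarrow> b \<in> pverts G \<Longrightarrow> \<not> twins (parcs G) a b"
    and no_config: "\<not> realizes_config G u v" "\<not> realizes_config G v u"
    and uv: "(u, v) \<in> parcs G"
  obtains a b c d where "P4_module (parcs G) a b c d"
proof -
  have neq: "u \<noteq> v" and V: "u \<in> pverts G" "v \<in> pverts G"
    using uv no_loops' in_arcsD1 in_arcsD2 by blast+
  then obtain p where p: "p \<noteq> u" "p \<noteq> v" "(u, p) \<in> parcs G \<longleftrightarrow> (v, p) \<notin> parcs G"
    using no_twins unfolding twins_def by blast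
  show thesis
  proof (cases "(v, p) \<in> parcs G")
    case True
    then show thesis
      using P4_module_if_no_config_private[OF no_twins no_config uv] p that by blast
  next
    case False
    then show thesis
      using P4_module_if_no_config_private[OF no_twins no_config(2,1) arcs_symmetric[OF uv]] p that
      by blast
  qed
qed

text \<open>With a fifth vertex, connectedness gives an edge leaving the module; its outer end is
  adjacent to all four vertices, in particular to \<open>a\<close> and \<open>b\<close>.\<close>

lemma edge_in_triangle_if_P4_module:
  assumes G: "connected_simple_graph G" and n: "card (pverts G) \<ge> 5"
    and M: "P4_module (parcs G) a b c d"
  shows "edge_in_triangle G a b"
proof -
  have pg: "pair_graph G" and conn: "Digraph_Component.connected (with_proj G)"
    using G by (auto simp: connected_simple_graph_def)
  interpret pair_graph G by fact
  have ab: "(a, b) \<in> parcs G" and sub: "{a, b, c, d} \<subseteq> pverts G"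
    using M unfolding P4_module_def by (auto dest: in_arcsD1 in_arcsD2)
  have "card {a, b, c, d} \<le> 4" by (simp add: card_insert_if)
  then have "{a, b, c, d} \<noteq> pverts G" using n by auto
  then have "{a, b, c, d} \<subset> pverts G" using sub by blast
  then obtain x y where "x \<in> {a, b, c, d}" "y \<in> pverts G - {a, b, c, d}" "(x, y) \<in> parcs G"
    using conn unfolding connected_iff_cut[OF pg] by blast
  then have "y \<in> pverts G" "(a, y) \<in> parcs G" "(b, y) \<in> parcs G"
    using M unfolding P4_module_def by blast+
  then show ?thesis using ab unfolding edge_in_triangle_def by auto
qed

theorem theorem4p12:
  fixes G :: "'a pair_pre_digraph"
  assumes "connected_simple_graph G"
    and "card (pverts G) \<ge> 5"
  shows "strongly_T3_reconstructible G \<longleftrightarrow>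
    (\<forall>v1 \<in> pverts G. \<forall>v2 \<in> pverts G. v1 \<noteq> v2 \<longrightarrow> nbrs G v1 - {v2} \<noteq> nbrs G v2 - {v1}) \<and>
    (\<forall>x y. edge_in_triangle G x y \<longrightarrow> realizes_config G x y \<or> realizes_config G y x)"
    (is "_ \<longleftrightarrow> ?A \<and> ?B")
proof -
  let ?E = "parcs G" and ?V = "pverts G"
  have "pair_graph G" using assms(1) by (simp add: connected_simple_graph_def)
  then interpret pair_graph G .
  note sym = sym_parcs and irrefl = irrefl_parcs and E = parcs_subset
  have no_twins_iff: "?A \<longleftrightarrow> (\<forall>a\<in>?V. \<forall>b\<in>?V. \<not> twins ?E a b)"
    using nbrs_minus_eq_iff_twins unfolding twins_def by blast
  have "card ?V \<ge> 3" using assms(2) by simp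
  note rec_iff = strongly_T3_reconstructible_iff[OF assms(1) this]
  show ?thesis
  proof
    assume rec: "strongly_T3_reconstructible G"
    \<comment> \<open>A flip preserving all majorities would be a second edge relation with the same
      triples.\<close>
    have no_flip: "\<not> same_triples ?E (flip ?E Q)"
      if "irrefl Q" "Q \<subseteq> ?V \<times> ?V" "Q \<noteq> {}" for Q
    proof -
      have "flip ?E Q \<subseteq> ?V \<times> ?V" using E that(2) unfolding flip_def by blast
      then show ?thesis
        using rec[unfolded rec_iff, rule_format, of "flip ?E Q"] sym_flip[OF sym]
          irrefl_flip[OF irrefl that(1)] flip_neq[OF that(3)] by blast
    qed
    have no_twins: "\<not> twins ?E a b" if "a \<in> ?V" "b \<in> ?V" for a b
    proof
      assume t: "twins ?E a b"
      then have "irrefl {(a, b)}" by (simp add: twins_def irrefl_def)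
      then show False using no_flip same_triples_flip_twins[OF sym t] that by blast
    qed
    have no_module: "\<not> P4_module ?E a b c d" for a b c d
    proof
      assume M: "P4_module ?E a b c d"
      have "irrefl (P4_module_pairs a b c d)" "P4_module_pairs a b c d \<noteq> {}"
        "P4_module_pairs a b c d \<subseteq> ?V \<times> ?V"
        using M E unfolding P4_module_def P4_module_pairs_def irrefl_def by auto
      then show False using no_flip same_triples_flip_P4_module[OF sym M] by blast
    qed
    have ?B
      using ex_P4_module_if_no_config[OF no_twins] no_module
      unfolding edge_in_triangle_def with_proj_simps by metis
    then show "?A \<and> ?B" using no_twins no_twins_iff by blast
  next
    assume AB: "?A \<and> ?B"
    show "strongly_T3_reconstructible G" unfolding rec_iff
    proof (intro allI impI, elim conjE)
      fix F assume F: "sym F" "irrefl F" "F \<subseteq> ?V \<times> ?V" "same_triples ?E F"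
      interpret same_triples_pair ?E F by unfold_locales fact+
      have "\<not> twins ?E a b" if "differ a b" for a b
      proof -
        have "a \<in> ?V" "b \<in> ?V" using that E F(3) unfolding differ_def by blast+
        then show ?thesis using AB no_twins_iff by blast
      qed
      \<comment> \<open>The end edge \<open>a b\<close> would lie in a triangle and yet realize no
        configuration, against (b).\<close>
      moreover have "\<not> P4_module ?E a b c d" for a b c d
        using AB edge_in_triangle_if_P4_module[OF assms] no_config_if_P4_module by blast
      ultimately show "F = ?E" using ex_P4_module by metis
    qed
  qed
qed

end
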